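(* Let $(A_{co},B_{co})$ be a controllable pair with $A_{co}\in\mathbb{R}^{n\times n}$, $B_{co}\in\mathbb{R}^{n\times n_u}$, and let $T_{jo}\in\mathbb{R}^{n\times n}$ and $G\in\mathbb{R}^{n_u\times n_u}$ be nonsingular and $F_{db}\in\mathbb{R}^{n_u\times n}$ such that $$A_b=T_{jo}(A_{co}+B_{co}F_{db})T_{jo}^{-1},\qquad B_b=T_{jo}B_{co}G,$$ where $(A_b,B_b)$ is in Brunovsky form. Consider the LQ optimal control problem in controllable coordinates $$\min_{x^c,u^c}\ \sum_{k=0}^{N-1}\Big(\tfrac12\begin{bmatrix}x_k^c \\ u_k^c\end{bmatrix}^\top\begin{bmatrix}Q_k^c&(S_k^c)^\top \\ S_k^c&R_k\end{bmatrix}\begin{bmatrix}x_k^c \\ u_k^c\end{bmatrix}+\begin{bmatrix}x_k^c \\ u_k^c\end{bmatrix}^\top\begin{bmatrix}q_k^c \\ r_k\end{bmatrix}\Big)+\tfrac12(x_N^c)^\top Q_N^cx_N^c+(x_N^c)^\top q_N^c$$ subject to $x_{k+1}^c=A_{co}x_k^c+B_{co}u_k^c+b_k^{co}$ for $0\le k\le N-1$, with $x_0^c\in\mathbb{R}^n$ given. Then the solution $\{x_k^{c*},u_k^{c*}\}$ of this problem can be obtained from the solution $\{z_k^*,v_k^*\}$ of the Brunovsky LQ optimal control problem defined in the context via $$x_k^{c*}=T_{jo}^{-1}z_k^*,\qquad u_k^{c*}=F_{db}x_k^{c*}+Gv_k^*.$$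
   Context: Data: $N$ is the horizon length; $Q_k^c\in\mathbb{R}^{n\times n}$ and $R_k\in\mathbb{R}^{n_u\times n_u}$ symmetric, $S_k^c\in\mathbb{R}^{n_u\times n}$, $q_k^c\in\mathbb{R}^n$, $r_k\in\mathbb{R}^{n_u}$, $b_k^{co}\in\mathbb{R}^n$. It is assumed that $R_k\succ0$ and $\begin{bmatrix}Q_k^c&(S_k^c)^\top \\ S_k^c&R_k\end{bmatrix}\succeq0$ for $0\le k\le N-1$, and $Q_N^c\succeq0$, which is sufficient for existence and uniqueness of the solution (minimizer) of the problem in controllable coordinates. Brunovsky form: for controllability indices $\mu_1,\dots,\mu_{n_u}$ with $\sum_i\mu_i=n$, $A_b=\operatorname{blkdiag}(A_1,\dots,A_{n_u})$ and $B_b=\operatorname{blkdiag}(B_1,\dots,B_{n_u})$ with $$A_i=\begin{bmatrix}0_{(\mu_i-1)\times1}&I_{\mu_i-1} \\ 0&0_{1\times(\mu_i-1)}\end{bmatrix},\qquad B_i=\begin{bmatrix}0_{(\mu_i-1)\times1} \\ 1\end{bmatrix}.$$ Brunovsky LQ optimal control problem (corresponding to applying $x^c=T_{jo}^{-1}z$ and $u^c=F_{db}x^c+Gv$ simultaneously): $$\min_{z,v}\ \sum_{k=0}^{N-1}\Big(\tfrac12\begin{bmatrix}z_k \\ v_k\end{bmatrix}^\top\begin{bmatrix}\tilde Q_k&\tilde S_k^\top \\ \tilde S_k&\tilde R_k\end{bmatrix}\begin{bmatrix}z_k \\ v_k\end{bmatrix}+\begin{bmatrix}z_k \\ v_k\end{bmatrix}^\top\begin{bmatrix}\tilde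 q_k \\ \tilde r_k\end{bmatrix}\Big)+\tfrac12z_N^\top\tilde Q_Nz_N+z_N^\top\tilde q_N$$ subject to $z_{k+1}=A_bz_k+B_bv_k+\tilde b_k$ for $0\le k\le N-1$, with $z_0=T_{jo}x_0^c$, where $$\tilde Q_k=T_{jo}^{-\top}\big(Q_k^c+F_{db}^\top R_kF_{db}\big)T_{jo}^{-1},\qquad \tilde R_k=G^\top R_kG,\qquad \tilde r_k=G^\top r_k,$$ $$\tilde S_k=G^\top(S_k^c+R_kF_{db})T_{jo}^{-1},\qquad \tilde q_k=T_{jo}^{-\top}(q_k^c+F_{db}^\top r_k),\qquad \tilde b_k=T_{jo}b_k^{co}$$ for $0\le k\le N-1$; at the terminal stage there is no input (no $R_N$, $r_N$), so $\tilde Q_N=T_{jo}^{-\top}Q_N^cT_{jo}^{-1}$ and $\tilde q_N=T_{jo}^{-\top}q_N^c$.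
   Formalization: For k<N the Brunovsky state weight is taken as T^{-T}(Q_k+F^T R_k F+F^T S_k+S_k^T F)T^{-1}; the printed formula omits the cross terms F^T S_k+S_k^T F, and with it the claim fails in general when S_k is nonzero. *)

theory Defs
  imports "Jordan_Normal_Form.Gauss_Jordan_Elimination" "Jordan_Normal_Form.DL_Rank"
begin

text \<open>Real matrices and vectors are those of \<open>Jordan_Normal_Form\<close>, with dimensions given by
  natural numbers, so that block-diagonal matrices with varying block sizes are available.\<close>

text \<open>Only meaningful for invertible arguments.\<close>

abbreviation mat_inv :: "real mat \<Rightarrow> real mat" where
  "mat_inv M \<equiv> the (mat_inverse M)"

definition symmetric_real_mat :: "nat \<Rightarrow> real mat \<Rightarrow> bool" where
  "symmetric_real_mat n M \<longleftrightarrow> M \<in> carrier_mat n n \<and> transpose_mat M = M"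

definition pos_semidef :: "nat \<Rightarrow> real mat \<Rightarrow> bool" where
  "pos_semidef n M \<longleftrightarrow> symmetric_real_mat n M \<and> (\<forall>x \<in> carrier_vec n. 0 \<le> x \<bullet> (M *\<^sub>v x))"

definition pos_def :: "nat \<Rightarrow> real mat \<Rightarrow> bool" where
  "pos_def n M \<longleftrightarrow> symmetric_real_mat n M \<and>
     (\<forall>x \<in> carrier_vec n. x \<noteq> 0\<^sub>v n \<longrightarrow> 0 < x \<bullet> (M *\<^sub>v x))"


subsection \<open>Controllability and the Brunovsky form\<close>

text \<open>The \<open>n \<times> (n * m)\<close> matrix \<open>[B, A B, ..., A^(n-1) B]\<close>.\<close>

definition controllability_matrix :: "nat \<Rightarrow> nat \<Rightarrow> real mat \<Rightarrow> real mat \<Rightarrow> real mat" where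
  "controllability_matrix n m A B =
     mat n (n * m) (\<lambda>(i, j). (A ^\<^sub>m (j div m) * B) $$ (i, j mod m))"

definition controllable_pair :: "nat \<Rightarrow> nat \<Rightarrow> real mat \<Rightarrow> real mat \<Rightarrow> bool" where
  "controllable_pair n m A B \<longleftrightarrow> A \<in> carrier_mat n n \<and> B \<in> carrier_mat n m \<and>
     vec_space.rank n (controllability_matrix n m A B) = n"

definition brunovsky_A_block :: "nat \<Rightarrow> real mat" where
  "brunovsky_A_block \<mu> = four_block_mat
     (0\<^sub>m (\<mu> - 1) 1) (1\<^sub>m (\<mu> - 1))
     (0\<^sub>m 1 1)       (0\<^sub>m 1 (\<mu> - 1))"

definition brunovsky_B_block :: "nat \<Rightarrow> real mat" where
  "brunovsky_B_block \<mu> = 0\<^sub>m (\<mu> - 1) 1 @\<^sub>r 1\<^sub>m 1"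

definition brunovsky_form :: "nat \<Rightarrow> nat \<Rightarrow> real mat \<Rightarrow> real mat \<Rightarrow> bool" where
  "brunovsky_form n m A B \<longleftrightarrow>
     (\<exists>\<mu>s. length \<mu>s = m \<and> (\<forall>\<mu> \<in> set \<mu>s. 1 \<le> \<mu>) \<and> sum_list \<mu>s = n \<and>
        A = diag_block_mat (map brunovsky_A_block \<mu>s) \<and>
        B = diag_block_mat (map brunovsky_B_block \<mu>s))"


subsection \<open>Linear-quadratic optimal control problems\<close>

text \<open>The weights \<open>Qw k\<close> and \<open>qw k\<close> are relevant for \<open>k \<le> horizon\<close>; the other stage data only for
  \<open>k < horizon\<close>.\<close>

record lq_problem =
  horizon :: nat
  Amat :: "real mat"
  Bmat :: "real mat"
  offset :: "nat \<Rightarrow> real vec"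
  Qw :: "nat \<Rightarrow> real mat"
  Rw :: "nat \<Rightarrow> real mat"
  Sw :: "nat \<Rightarrow> real mat"
  qw :: "nat \<Rightarrow> real vec"
  rw :: "nat \<Rightarrow> real vec"
  init :: "real vec"

definition stage_weight :: "lq_problem \<Rightarrow> nat \<Rightarrow> real mat" where
  "stage_weight P k = four_block_mat (Qw P k) (transpose_mat (Sw P k)) (Sw P k) (Rw P k)"

definition lq_data :: "nat \<Rightarrow> nat \<Rightarrow> lq_problem \<Rightarrow> bool" where
  "lq_data n m P \<longleftrightarrow>
     Amat P \<in> carrier_mat n n \<and> Bmat P \<in> carrier_mat n m \<and> init P \<in> carrier_vec n \<and>
     (\<forall>k < horizon P.
        offset P k \<in> carrier_vec n \<and>
        symmetric_real_mat n (Qw P k) \<and> symmetric_real_mat m (Rw P k) \<and>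
        Sw P k \<in> carrier_mat m n \<and> qw P k \<in> carrier_vec n \<and> rw P k \<in> carrier_vec m) \<and>
     symmetric_real_mat n (Qw P (horizon P)) \<and> qw P (horizon P) \<in> carrier_vec n"

definition lq_convex :: "nat \<Rightarrow> nat \<Rightarrow> lq_problem \<Rightarrow> bool" where
  "lq_convex n m P \<longleftrightarrow>
     (\<forall>k < horizon P. pos_def m (Rw P k) \<and> pos_semidef (n + m) (stage_weight P k)) \<and>
     pos_semidef n (Qw P (horizon P))"

definition lq_cost :: "lq_problem \<Rightarrow> (nat \<Rightarrow> real vec) \<Rightarrow> (nat \<Rightarrow> real vec) \<Rightarrow> real" where
  "lq_cost P x u =
     (\<Sum>k<horizon P.
        1/2 * ((x k @\<^sub>v u k) \<bullet> (stage_weight P k *\<^sub>v (x k @\<^sub>v u k)))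
        + (x k @\<^sub>v u k) \<bullet> (qw P k @\<^sub>v rw P k))
     + 1/2 * (x (horizon P) \<bullet> (Qw P (horizon P) *\<^sub>v x (horizon P)))
     + x (horizon P) \<bullet> qw P (horizon P)"

definition lq_feasible :: "lq_problem \<Rightarrow> (nat \<Rightarrow> real vec) \<Rightarrow> (nat \<Rightarrow> real vec) \<Rightarrow> bool" where
  "lq_feasible P x u \<longleftrightarrow>
     (\<forall>k \<le> horizon P. x k \<in> carrier_vec (dim_row (Amat P))) \<and>
     (\<forall>k < horizon P. u k \<in> carrier_vec (dim_col (Bmat P))) \<and>
     x 0 = init P \<and>
     (\<forall>k < horizon P. x (Suc k) = Amat P *\<^sub>v x k + Bmat P *\<^sub>v u k + offset P k)"

definition lq_minimizer :: "lq_problem \<Rightarrow> (nat \<Rightarrow> real vec) \<Rightarrow> (nat \<Rightarrow> real vec) \<Rightarrow> bool" where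
  "lq_minimizer P x u \<longleftrightarrow>
     lq_feasible P x u \<and> (\<forall>x' u'. lq_feasible P x' u' \<longrightarrow> lq_cost P x u \<le> lq_cost P x' u')"

text \<open>\<^emph>\<open>The\<close> solution, i.e. the unique minimizer. Trajectories are functions on all of \<open>nat\<close>,
  so uniqueness is agreement on the time indices that occur in the problem.\<close>

definition lq_solution :: "lq_problem \<Rightarrow> (nat \<Rightarrow> real vec) \<Rightarrow> (nat \<Rightarrow> real vec) \<Rightarrow> bool" where
  "lq_solution P x u \<longleftrightarrow> lq_minimizer P x u \<and>
     (\<forall>x' u'. lq_minimizer P x' u' \<longrightarrow>
        (\<forall>k \<le> horizon P. x' k = x k) \<and> (\<forall>k < horizon P. u' k = u k))"


subsection \<open>The problem in Brunovsky coordinates\<close>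

text \<open>The data obtained by applying \<open>x = T\<inverse> z\<close> and \<open>u = F x + G v\<close> simultaneously. The mixed
  term \<open>u \<bullet> S x\<close> of the stage cost contributes \<open>x \<bullet> (F\<^sup>T S) x\<close>, hence the summand \<open>F\<^sup>T S + S\<^sup>T F\<close>
  in the state weight. The shorter expression \<open>T\<inverse>\<^sup>T (Q + F\<^sup>T R F) T\<inverse>\<close> is correct only if this
  summand vanishes, for instance if \<open>S = 0\<close>. The terminal stage has no input.\<close>

definition brunovsky_problem ::
    "real mat \<Rightarrow> real mat \<Rightarrow> real mat \<Rightarrow> real mat \<Rightarrow> real mat \<Rightarrow> lq_problem \<Rightarrow> lq_problem" where
  "brunovsky_problem A\<^sub>b B\<^sub>b T F G P =
     \<lparr> horizon = horizon P,
       Amat = A\<^sub>b,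
       Bmat = B\<^sub>b,
       offset = (\<lambda>k. T *\<^sub>v offset P k),
       Qw = (\<lambda>k. if k < horizon P
               then transpose_mat (mat_inv T) *
                    (Qw P k + transpose_mat F * Rw P k * F
                     + (transpose_mat F * Sw P k + transpose_mat (Sw P k) * F)) * mat_inv T
               else transpose_mat (mat_inv T) * Qw P k * mat_inv T),
       Rw = (\<lambda>k. transpose_mat G * Rw P k * G),
       Sw = (\<lambda>k. transpose_mat G * (Sw P k + Rw P k * F) * mat_inv T),
       qw = (\<lambda>k. if k < horizon P
               then transpose_mat (mat_inv T) *\<^sub>v (qw P k + transpose_mat F *\<^sub>v rw P k)
               else transpose_mat (mat_inv T) *\<^sub>v qw P k),
       rw = (\<lambda>k. transpose_mat G *\<^sub>v rw P k),
       init = T *\<^sub>v init P \<rparr>"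

end

theory Submission
  imports Defs
begin

text \<open>Write \<open>x = T\<inverse> z\<close> and \<open>u = F x + G v\<close>. Because \<open>T\<close> and \<open>G\<close> are invertible, this is a
  bijection between state-input trajectories \<open>(z, v)\<close> and \<open>(x, u)\<close> on the time horizon. It
  identifies the trajectories that are feasible for the transformed problem with those that are
  feasible for the original one (\<open>corresponds_feasible\<close>), and it preserves the cost
  (\<open>corresponds_cost\<close>): inserting the substitution into the stage cost produces exactly the
  weights of the transformed problem, where the mixed term \<open>u \<bullet> S x\<close> is responsible for the
  summand \<open>F\<^sup>T S + S\<^sup>T F\<close> in the state weight. A cost-preserving bijection between the feasible sets
  carries the unique minimizer of either problem to the unique minimizer of the other
  (\<open>lq_solution_transfer\<close>). This gives the conversion of solutions.

  That there is a solution to convert is shown in the original coordinates, where convexity is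
  assumed, by dynamic programming (\<open>lq_solution_exists\<close>). Going backwards in time, the optimal
  cost-to-go is a convex quadratic function of the state: if \<open>V\<close> is convex quadratic, then so is
  the sum of the stage cost and \<open>V (A x + B u + b)\<close> in \<open>(x, u)\<close>; its Hessian in \<open>u\<close> dominates
  \<open>R\<close> and is therefore positive definite, so that for each \<open>x\<close> there is exactly one minimizing
  \<open>u\<close>, which depends affinely on \<open>x\<close>; and substituting an affine function into a convex quadratic
  function leaves it convex quadratic (\<open>bellman_step\<close>). The cost of a feasible trajectory exceeds
  the cost-to-go at its initial state by the sum of nonnegative losses, one for each stage. A loss
  vanishes only if the input obeys the optimal feedback law, so exactly one trajectory is
  optimal.\<close>


section \<open>Matrix preliminaries\<close>

lemma mult_mat_vec_scalar_prod:
  fixes A :: "real mat"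
  assumes "A \<in> carrier_mat nr nc" "x \<in> carrier_vec nc" "y \<in> carrier_vec nr"
  shows "(A *\<^sub>v x) \<bullet> y = x \<bullet> (transpose_mat A *\<^sub>v y)"
  using transpose_vec_mult_scalar[OF assms] assms
  by (metis comm_scalar_prod mult_mat_vec_carrier transpose_carrier_mat)

lemma mult_mat_vec_zero:
  fixes A :: "real mat"
  assumes "A \<in> carrier_mat nr nc"
  shows "A *\<^sub>v 0\<^sub>v nc = 0\<^sub>v nr"
  using assms by (intro eq_vecI) auto

lemma mult_mat_vec_uminus:
  fixes A :: "real mat"
  assumes "A \<in> carrier_mat nr nc" "x \<in> carrier_vec nc"
  shows "A *\<^sub>v (- x) = - (A *\<^sub>v x)"
  using assms by (intro eq_vecI) auto

lemma symmetric_scalar_prod: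
  assumes "symmetric_real_mat n M" "x \<in> carrier_vec n" "y \<in> carrier_vec n"
  shows "x \<bullet> (M *\<^sub>v y) = y \<bullet> (M *\<^sub>v x)"
proof -
  have M: "M \<in> carrier_mat n n" "transpose_mat M = M"
    using assms by (auto simp: symmetric_real_mat_def)
  show ?thesis
    using mult_mat_vec_scalar_prod[OF M(1) assms(3,2)] M assms
    by (metis comm_scalar_prod mult_mat_vec_carrier)
qed

lemma vec_split_append:
  assumes "x \<in> carrier_vec n" "u \<in> carrier_vec m"
  shows "(x @\<^sub>v u :: real vec) = (x @\<^sub>v 0\<^sub>v m) + (0\<^sub>v n @\<^sub>v u)"
  using assms by (intro eq_vecI) auto


section \<open>Convex quadratic functions and their partial minimization\<close>

definition quad :: "real mat \<Rightarrow> real vec \<Rightarrow> real \<Rightarrow> real vec \<Rightarrow> real" where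
  "quad M p c x = 1/2 * (x \<bullet> (M *\<^sub>v x)) + x \<bullet> p + c"

text \<open>The representation by \<open>quad\<close> is required only on vectors of the right dimension, since value
  functions are not controlled anywhere else.\<close>

definition convex_quadratic :: "nat \<Rightarrow> (real vec \<Rightarrow> real) \<Rightarrow> bool" where
  "convex_quadratic n V \<longleftrightarrow> (\<exists>M p c. pos_semidef n M \<and> p \<in> carrier_vec n \<and>
     (\<forall>x \<in> carrier_vec n. V x = quad M p c x))"

lemma quad_add:
  assumes M: "symmetric_real_mat n M" and p: "p \<in> carrier_vec n"
    and y: "y \<in> carrier_vec n" and e: "e \<in> carrier_vec n"
  shows "quad M p c (y + e) = quad M p c y + e \<bullet> (M *\<^sub>v y + p) + 1/2 * (e \<bullet> (M *\<^sub>v e))"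
proof -
  have M': "M \<in> carrier_mat n n" using M by (simp add: symmetric_real_mat_def)
  note [simp] = mult_mat_vec_carrier[OF M']
  have "(y + e) \<bullet> (M *\<^sub>v (y + e)) =
      y \<bullet> (M *\<^sub>v y) + y \<bullet> (M *\<^sub>v e) + e \<bullet> (M *\<^sub>v y) + e \<bullet> (M *\<^sub>v e)"
    using y e by (simp add: mult_add_distrib_mat_vec[OF M'] add_scalar_prod_distrib[of _ n]
        scalar_prod_add_distrib[of _ n])
  moreover have "y \<bullet> (M *\<^sub>v e) = e \<bullet> (M *\<^sub>v y)"
    by (rule symmetric_scalar_prod[OF M y e])
  moreover have "(y + e) \<bullet> p = y \<bullet> p + e \<bullet> p"
    using y e p by (simp add: add_scalar_prod_distrib[of _ n])
  moreover have "e \<bullet> (M *\<^sub>v y + p) = e \<bullet> (M *\<^sub>v y) + e \<bullet> p"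
    using y e p by (simp add: scalar_prod_add_distrib[of _ n])
  ultimately show ?thesis by (simp add: quad_def algebra_simps)
qed

lemma quad_affine:
  assumes M: "symmetric_real_mat n M" and p: "p \<in> carrier_vec n"
    and C: "C \<in> carrier_mat n k" and b: "b \<in> carrier_vec n" and x: "x \<in> carrier_vec k"
  shows "quad M p c (C *\<^sub>v x + b) =
    quad (transpose_mat C * M * C) (transpose_mat C *\<^sub>v (M *\<^sub>v b + p)) (quad M p c b) x"
proof -
  have M': "M \<in> carrier_mat n n" using M by (simp add: symmetric_real_mat_def)
  have Cx: "C *\<^sub>v x \<in> carrier_vec n" using C x by simp
  have "quad M p c (C *\<^sub>v x + b) = quad M p c (b + C *\<^sub>v x)"
    using Cx b by (simp add: comm_add_vec)
  also have "\<dots> = quad M p c b + (C *\<^sub>v x) \<bullet> (M *\<^sub>v b + p) + 1/2 * ((C *\<^sub>v x) \<bullet> (M *\<^sub>v (C *\<^sub>v x)))"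
    by (rule quad_add[OF M p b Cx])
  also have "(C *\<^sub>v x) \<bullet> (M *\<^sub>v b + p) = x \<bullet> (transpose_mat C *\<^sub>v (M *\<^sub>v b + p))"
    using C x M' b p by (intro mult_mat_vec_scalar_prod) auto
  also have "(C *\<^sub>v x) \<bullet> (M *\<^sub>v (C *\<^sub>v x)) = x \<bullet> (transpose_mat C *\<^sub>v (M *\<^sub>v (C *\<^sub>v x)))"
    using C x M' by (intro mult_mat_vec_scalar_prod) auto
  also have "transpose_mat C *\<^sub>v (M *\<^sub>v (C *\<^sub>v x)) = (transpose_mat C * M * C) *\<^sub>v x"
    using C x M' by (simp add: assoc_mult_mat_vec[of _ k n _ k] assoc_mult_mat_vec[of _ k n _ n])
  finally show ?thesis by (simp add: quad_def)
qed

lemma pos_semidef_congruence: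
  assumes M: "pos_semidef n M" and C: "C \<in> carrier_mat n k"
  shows "pos_semidef k (transpose_mat C * M * C)"
proof -
  have M': "M \<in> carrier_mat n n" "transpose_mat M = M"
    using M by (auto simp: pos_semidef_def symmetric_real_mat_def)
  have assoc: "transpose_mat C * M * C = transpose_mat C * (M * C)"
    using C M'(1) by (intro assoc_mult_mat[of _ k n _ n _ k]) auto
  have "transpose_mat (transpose_mat C * M * C) = transpose_mat (M * C) * C"
    unfolding assoc using C M'(1) by (subst transpose_mult[of _ k n _ k]) auto
  also have "transpose_mat (M * C) = transpose_mat C * M"
    using C M' by (subst transpose_mult[of _ n n _ k]) auto
  finally have sym: "symmetric_real_mat k (transpose_mat C * M * C)"
    using C M' by (simp add: symmetric_real_mat_def)
  have "0 \<le> x \<bullet> ((transpose_mat C * M * C) *\<^sub>v x)" if x: "x \<in> carrier_vec k" for x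
  proof -
    have "x \<bullet> ((transpose_mat C * M * C) *\<^sub>v x) = x \<bullet> (transpose_mat C *\<^sub>v (M *\<^sub>v (C *\<^sub>v x)))"
      using C x M' by (simp add: assoc_mult_mat_vec[of _ k n _ k] assoc_mult_mat_vec[of _ k n _ n])
    also have "\<dots> = (C *\<^sub>v x) \<bullet> (M *\<^sub>v (C *\<^sub>v x))"
      using C x M' by (intro mult_mat_vec_scalar_prod[symmetric]) auto
    also have "\<dots> \<ge> 0" using M C x by (simp add: pos_semidef_def)
    finally show ?thesis .
  qed
  with sym show ?thesis by (simp add: pos_semidef_def)
qed

lemma convex_quadratic_affine:
  assumes V: "convex_quadratic n V" and C: "C \<in> carrier_mat n k" and b: "b \<in> carrier_vec n"
  shows "convex_quadratic k (\<lambda>x. V (C *\<^sub>v x + b))"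
proof -
  obtain M p c where M: "pos_semidef n M" and p: "p \<in> carrier_vec n"
    and V: "\<And>x. x \<in> carrier_vec n \<Longrightarrow> V x = quad M p c x"
    using V by (auto simp: convex_quadratic_def)
  have sym: "symmetric_real_mat n M" and M': "M \<in> carrier_mat n n"
    using M by (auto simp: pos_semidef_def symmetric_real_mat_def)
  have "V (C *\<^sub>v x + b) =
      quad (transpose_mat C * M * C) (transpose_mat C *\<^sub>v (M *\<^sub>v b + p)) (quad M p c b) x"
    if x: "x \<in> carrier_vec k" for x
    using V[of "C *\<^sub>v x + b"] quad_affine[OF sym p C b x] C b x by simp
  moreover have "transpose_mat C *\<^sub>v (M *\<^sub>v b + p) \<in> carrier_vec k"
    using C M' b p by simp
  ultimately show ?thesis
    using pos_semidef_congruence[OF M C] by (auto simp: convex_quadratic_def)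
qed

lemma mat_inv_invertible:
  fixes M :: "real mat"
  assumes M: "M \<in> carrier_mat n n" and inv: "invertible_mat M"
  shows "mat_inv M \<in> carrier_mat n n" "M * mat_inv M = 1\<^sub>m n" "mat_inv M * M = 1\<^sub>m n"
proof -
  obtain B where B: "M * B = 1\<^sub>m n" "B * M = 1\<^sub>m (dim_row B)"
    using inv M by (auto simp: invertible_mat_def inverts_mat_def)
  have "dim_col (M * B) = n" "dim_col (B * M) = dim_row B" unfolding B by simp_all
  hence BC: "B \<in> carrier_mat n n" using M by auto
  hence "M \<in> Units (ring_mat TYPE(real) n ())"
    using M B by (auto simp: Units_def ring_mat_def)
  then obtain C where "mat_inverse M = Some C"
    using mat_inverse(1)[OF M, where b = "()"] by (cases "mat_inverse M") auto
  with mat_inverse(2)[OF M this]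
  show "mat_inv M \<in> carrier_mat n n" "M * mat_inv M = 1\<^sub>m n" "mat_inv M * M = 1\<^sub>m n" by auto
qed

lemma pos_def_inverse:
  assumes "pos_def m R"
  obtains R' where "R' \<in> carrier_mat m m" "R * R' = 1\<^sub>m m"
proof -
  have R: "R \<in> carrier_mat m m" and pos: "\<And>x. x \<in> carrier_vec m \<Longrightarrow> x \<noteq> 0\<^sub>v m \<Longrightarrow> 0 < x \<bullet> (R *\<^sub>v x)"
    using assms by (auto simp: pos_def_def symmetric_real_mat_def)
  have "det R \<noteq> 0"
  proof
    assume "det R = 0"
    then obtain v where "v \<in> carrier_vec m" "v \<noteq> 0\<^sub>v m" "R *\<^sub>v v = 0\<^sub>v m"
      using det_0_iff_vec_prod_zero[OF R] by blast
    with pos[of v] show False by simp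
  qed
  from det_non_zero_imp_unit[OF R this, where b = "()"] that show ?thesis
    by (auto simp: Units_def ring_mat_def)
qed

text \<open>For fixed \<open>x\<close> the function has a positive definite Hessian \<open>R = E\<^sup>T H E\<close> in \<open>u\<close>, where \<open>E\<close>
  embeds the inputs as the vectors \<open>(0, u)\<close>. Hence \<open>R\<close> is invertible, the stationarity equation
  in \<open>u\<close> has a solution \<open>g x\<close>, and expanding around \<open>(x, g x)\<close> leaves only the positive
  quadratic term in \<open>u - g x\<close>. Since \<open>g\<close> is affine, the minimum \<open>V\<close> is the composition of a
  convex quadratic function with the affine map \<open>x \<mapsto> (x, g x)\<close>, which makes it convex without
  any computation of a Schur complement.\<close>

lemma partial_minimization:
  assumes H: "pos_semidef (n + m) H" and h: "h \<in> carrier_vec (n + m)"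
    and strict: "\<And>d. d \<in> carrier_vec m \<Longrightarrow> d \<noteq> 0\<^sub>v m \<Longrightarrow> 0 < (0\<^sub>v n @\<^sub>v d) \<bullet> (H *\<^sub>v (0\<^sub>v n @\<^sub>v d))"
  shows "\<exists>V g. convex_quadratic n V \<and> (\<forall>x \<in> carrier_vec n. g x \<in> carrier_vec m \<and>
    (\<forall>u \<in> carrier_vec m. V x \<le> quad H h c (x @\<^sub>v u) \<and> (V x = quad H h c (x @\<^sub>v u) \<longleftrightarrow> u = g x)))"
proof -
  define E where "E = 0\<^sub>m n m @\<^sub>r (1\<^sub>m m :: real mat)"
  define J where "J = 1\<^sub>m n @\<^sub>r (0\<^sub>m m n :: real mat)"
  define R where "R = transpose_mat E * H * E"
  have HC: "H \<in> carrier_mat (n + m) (n + m)" and Hsym: "symmetric_real_mat (n + m) H"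
    using H by (auto simp: pos_semidef_def symmetric_real_mat_def)
  have E: "E \<in> carrier_mat (n + m) m" unfolding E_def by (intro carrier_append_rows) auto
  have J: "J \<in> carrier_mat (n + m) n" unfolding J_def by (intro carrier_append_rows) auto
  have ET: "transpose_mat E \<in> carrier_mat m (n + m)" using E by simp
  have E_vec: "E *\<^sub>v d = 0\<^sub>v n @\<^sub>v d" if "d \<in> carrier_vec m" for d
    unfolding E_def using that by (subst mat_mult_append[of _ n m]) auto
  have J_vec: "J *\<^sub>v x = x @\<^sub>v 0\<^sub>v m" if "x \<in> carrier_vec n" for x
    unfolding J_def using that by (subst mat_mult_append[of _ n n]) auto
  have R_vec: "R *\<^sub>v d = transpose_mat E *\<^sub>v (H *\<^sub>v (E *\<^sub>v d))" if "d \<in> carrier_vec m" for d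
    unfolding R_def using E HC that
    by (simp add: assoc_mult_mat_vec[of _ m "n+m" _ m] assoc_mult_mat_vec[of _ m "n+m" _ "n+m"])
  have R_form: "d \<bullet> (R *\<^sub>v d) = (E *\<^sub>v d) \<bullet> (H *\<^sub>v (E *\<^sub>v d))" if d: "d \<in> carrier_vec m" for d
    unfolding R_vec[OF d] using E HC d by (intro mult_mat_vec_scalar_prod[symmetric]) auto
  have "pos_semidef m R" unfolding R_def by (rule pos_semidef_congruence[OF H E])
  hence RC: "R \<in> carrier_mat m m" and "pos_def m R"
    using strict R_form E_vec by (auto simp: pos_semidef_def pos_def_def symmetric_real_mat_def)
  then obtain R' where R': "R' \<in> carrier_mat m m" "R * R' = 1\<^sub>m m" using pos_def_inverse by blast
  \<comment> \<open>These are the coefficients of the solution of \<open>E\<^sup>T (H (x, u) + h) = 0\<close> for \<open>u\<close>: as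
    \<open>(x, u) = J x + E u\<close>, the equation reads \<open>R u = - E\<^sup>T H J x - E\<^sup>T h\<close>.\<close>
  define K where "K = R' * (- (transpose_mat E * H * J))"
  define k where "k = R' *\<^sub>v (- (transpose_mat E *\<^sub>v h))"
  define g where "g = (\<lambda>x. K *\<^sub>v x + k)"
  have K: "K \<in> carrier_mat m n" unfolding K_def using R' E HC J by auto
  have k: "k \<in> carrier_vec m" unfolding k_def using R' E h by auto
  have g: "g x \<in> carrier_vec m" if "x \<in> carrier_vec n" for x
    unfolding g_def using K k that by simp
  have stat: "transpose_mat E *\<^sub>v (H *\<^sub>v (x @\<^sub>v g x) + h) = 0\<^sub>v m" if x: "x \<in> carrier_vec n" for x
  proof -
    have RR': "R *\<^sub>v (R' *\<^sub>v w) = w" if "w \<in> carrier_vec m" for w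
      using assoc_mult_mat_vec[OF RC R'(1) that] R'(2) that by simp
    let ?w = "transpose_mat E *\<^sub>v (H *\<^sub>v (J *\<^sub>v x))"
    have w: "?w \<in> carrier_vec m" using E HC J x by auto
    have "K *\<^sub>v x = R' *\<^sub>v (- ?w)"
      unfolding K_def using R' E HC J x
      by (simp add: assoc_mult_mat_vec[of _ m m _ n] assoc_mult_mat_vec[of _ m "n+m" _ n]
          assoc_mult_mat_vec[of _ m "n+m" _ "n+m"] mult_mat_vec_uminus[of _ m m])
    hence "R *\<^sub>v g x = - ?w - transpose_mat E *\<^sub>v h"
      unfolding g_def k_def using mult_add_distrib_mat_vec[OF RC, of "K *\<^sub>v x" k] K k x w E h R'
      by (simp add: k_def RR' minus_add_uminus_vec[of _ m])
    moreover have "H *\<^sub>v (x @\<^sub>v g x) = H *\<^sub>v (J *\<^sub>v x) + H *\<^sub>v (E *\<^sub>v g x)"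
      using vec_split_append[OF x g[OF x]] J_vec[OF x] E_vec[OF g[OF x]]
        mult_add_distrib_mat_vec[OF HC, of "J *\<^sub>v x" "E *\<^sub>v g x"] J E x g[OF x] by simp
    hence "transpose_mat E *\<^sub>v (H *\<^sub>v (x @\<^sub>v g x) + h) = ?w + R *\<^sub>v g x + transpose_mat E *\<^sub>v h"
      using HC J E x g[OF x] h R_vec[OF g[OF x]] by (simp add: mult_add_distrib_mat_vec[OF ET])
    ultimately show ?thesis using w E h by auto
  qed
  define V where "V = (\<lambda>x. quad H h c (x @\<^sub>v g x))"
  have "convex_quadratic (n + m) (quad H h c)"
    using H h by (auto simp: convex_quadratic_def)
  hence "convex_quadratic n (\<lambda>x. quad H h c ((J + E * K) *\<^sub>v x + E *\<^sub>v k))"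
    using J E K k by (intro convex_quadratic_affine[of "n + m"]) auto
  moreover have "(J + E * K) *\<^sub>v x + E *\<^sub>v k = x @\<^sub>v g x" if x: "x \<in> carrier_vec n" for x
  proof -
    have "(J + E * K) *\<^sub>v x + E *\<^sub>v k = J *\<^sub>v x + (E *\<^sub>v (K *\<^sub>v x) + E *\<^sub>v k)"
      using J E K k x
      by (simp add: add_mult_distrib_mat_vec[of _ "n+m" n] assoc_mult_mat_vec[of _ "n+m" m _ n] assoc_add_vec[of _ "n+m"])
    also have "E *\<^sub>v (K *\<^sub>v x) + E *\<^sub>v k = E *\<^sub>v g x"
      unfolding g_def using E K k x by (simp add: mult_add_distrib_mat_vec[of _ "n+m" m])
    finally show ?thesis
      using vec_split_append[OF x g[OF x]] J_vec[OF x] E_vec[OF g[OF x]] by simp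
  qed
  ultimately have "convex_quadratic n V" unfolding V_def convex_quadratic_def by simp
  moreover have "V x \<le> quad H h c (x @\<^sub>v u) \<and> (V x = quad H h c (x @\<^sub>v u) \<longleftrightarrow> u = g x)"
    if x: "x \<in> carrier_vec n" and u: "u \<in> carrier_vec m" for x u
  proof -
    define d where "d = u - g x"
    have d: "d \<in> carrier_vec m" unfolding d_def using u g[OF x] by simp
    have ud: "u = g x + d" unfolding d_def using u g[OF x] by auto
    have xu: "x @\<^sub>v u = (x @\<^sub>v g x) + E *\<^sub>v d"
      unfolding E_vec[OF d] unfolding ud using x d g[OF x] by (intro eq_vecI) auto
    have y: "x @\<^sub>v g x \<in> carrier_vec (n + m)" using x g[OF x] by simp
    have Ed: "E *\<^sub>v d \<in> carrier_vec (n + m)" using E d by simp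
    have "(E *\<^sub>v d) \<bullet> (H *\<^sub>v (x @\<^sub>v g x) + h) = d \<bullet> 0\<^sub>v m"
      unfolding stat[OF x, symmetric] using E d HC y h by (intro mult_mat_vec_scalar_prod) auto
    hence "quad H h c (x @\<^sub>v u) = V x + 1/2 * ((E *\<^sub>v d) \<bullet> (H *\<^sub>v (E *\<^sub>v d)))"
      unfolding xu V_def quad_add[OF Hsym h y Ed] using d by simp
    moreover have "u = g x \<longleftrightarrow> d = 0\<^sub>v m"
      using ud u g[OF x] d by (auto simp: d_def)
    moreover have "d \<noteq> 0\<^sub>v m \<Longrightarrow> 0 < (E *\<^sub>v d) \<bullet> (H *\<^sub>v (E *\<^sub>v d))"
      using strict[OF d] E_vec[OF d] by simp
    moreover have "d = 0\<^sub>v m \<Longrightarrow> (E *\<^sub>v d) \<bullet> (H *\<^sub>v (E *\<^sub>v d)) = 0"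
      using mult_mat_vec_zero[OF E] mult_mat_vec_zero[OF HC] by simp
    ultimately show ?thesis by (cases "d = 0\<^sub>v m") auto
  qed
  ultimately show ?thesis using g by blast
qed


lemma pos_semidef_add:
  assumes "pos_semidef n M" "pos_semidef n N"
  shows "pos_semidef n (M + N)"
proof -
  have C: "M \<in> carrier_mat n n" "N \<in> carrier_mat n n" "transpose_mat M = M" "transpose_mat N = N"
    using assms by (auto simp: pos_semidef_def symmetric_real_mat_def)
  have "x \<bullet> ((M + N) *\<^sub>v x) = x \<bullet> (M *\<^sub>v x) + x \<bullet> (N *\<^sub>v x)" if "x \<in> carrier_vec n" for x
    using C that by (simp add: add_mult_distrib_mat_vec[of _ n n] scalar_prod_add_distrib[of _ n])
  thus ?thesis
    using assms C by (auto simp: pos_semidef_def symmetric_real_mat_def transpose_add[of _ n n])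
qed


section \<open>Existence and uniqueness by dynamic programming\<close>

text \<open>Adding the convex cost-to-go \<open>V\<close> at the successor state can only increase the curvature in
  the input direction, so the strict convexity in \<open>u\<close> provided by the stage weight survives and
  partial minimization applies to the sum.\<close>

lemma bellman_step:
  assumes W: "pos_semidef (n + m) W" and s: "s \<in> carrier_vec (n + m)"
    and strict: "\<And>d. d \<in> carrier_vec m \<Longrightarrow> d \<noteq> 0\<^sub>v m \<Longrightarrow> 0 < (0\<^sub>v n @\<^sub>v d) \<bullet> (W *\<^sub>v (0\<^sub>v n @\<^sub>v d))"
    and V: "convex_quadratic n V"
    and A: "A \<in> carrier_mat n n" and B: "B \<in> carrier_mat n m" and b: "b \<in> carrier_vec n"
  shows "\<exists>V' g. convex_quadratic n V' \<and> (\<forall>x \<in> carrier_vec n. g x \<in> carrier_vec m \<and>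
    (\<forall>u \<in> carrier_vec m. V' x \<le> quad W s 0 (x @\<^sub>v u) + V (A *\<^sub>v x + B *\<^sub>v u + b) \<and>
      (V' x = quad W s 0 (x @\<^sub>v u) + V (A *\<^sub>v x + B *\<^sub>v u + b) \<longleftrightarrow> u = g x)))"
proof -
  \<comment> \<open>The matrix \<open>[A B]\<close>, with an empty lower block row.\<close>
  define C where "C = four_block_mat A B (0\<^sub>m 0 n) (0\<^sub>m 0 m)"
  have C: "C \<in> carrier_mat n (n + m)"
    unfolding C_def using four_block_carrier_mat[OF A, of "0\<^sub>m 0 m" 0 m B "0\<^sub>m 0 n"] by simp
  have C_vec: "C *\<^sub>v (x @\<^sub>v u) = A *\<^sub>v x + B *\<^sub>v u" if "x \<in> carrier_vec n" "u \<in> carrier_vec m" for x u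
    unfolding C_def using A B that
    by (subst four_block_mat_mult_vec[of _ n n _ m _ 0]) (auto intro!: eq_vecI)
  obtain M p c where M: "pos_semidef (n + m) M" and p: "p \<in> carrier_vec (n + m)"
    and VC: "\<And>y. y \<in> carrier_vec (n + m) \<Longrightarrow> V (C *\<^sub>v y + b) = quad M p c y"
    using convex_quadratic_affine[OF V C b] by (auto simp: convex_quadratic_def)
  have carr: "W \<in> carrier_mat (n + m) (n + m)" "M \<in> carrier_mat (n + m) (n + m)"
    using W M by (auto simp: pos_semidef_def symmetric_real_mat_def)
  have split: "y \<bullet> ((W + M) *\<^sub>v y) = y \<bullet> (W *\<^sub>v y) + y \<bullet> (M *\<^sub>v y)"
    if "y \<in> carrier_vec (n + m)" for y
    using carr that
    by (simp add: add_mult_distrib_mat_vec[of _ "n+m" "n+m"] scalar_prod_add_distrib[of _ "n+m"])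
  have sum: "quad (W + M) (s + p) c (x @\<^sub>v u) = quad W s 0 (x @\<^sub>v u) + V (A *\<^sub>v x + B *\<^sub>v u + b)"
    if "x \<in> carrier_vec n" "u \<in> carrier_vec m" for x u
  proof -
    have y: "x @\<^sub>v u \<in> carrier_vec (n + m)" using that by simp
    show ?thesis
      using VC[OF y] C_vec[OF that] split[OF y] s p y
      by (simp add: quad_def scalar_prod_add_distrib[of _ "n+m"] algebra_simps)
  qed
  have "0 < (0\<^sub>v n @\<^sub>v d) \<bullet> ((W + M) *\<^sub>v (0\<^sub>v n @\<^sub>v d))" if d: "d \<in> carrier_vec m" "d \<noteq> 0\<^sub>v m" for d
  proof -
    have y: "0\<^sub>v n @\<^sub>v d \<in> carrier_vec (n + m)" using d by simp
    have "0 \<le> (0\<^sub>v n @\<^sub>v d) \<bullet> (M *\<^sub>v (0\<^sub>v n @\<^sub>v d))" using M y by (simp add: pos_semidef_def)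
    with strict[OF d] show ?thesis unfolding split[OF y] by simp
  qed
  from partial_minimization[OF pos_semidef_add[OF W M] _ this, of "s + p" c] s p
  obtain V' g where "convex_quadratic n V'" and "\<forall>x \<in> carrier_vec n. g x \<in> carrier_vec m \<and>
    (\<forall>u \<in> carrier_vec m. V' x \<le> quad (W + M) (s + p) c (x @\<^sub>v u) \<and>
      (V' x = quad (W + M) (s + p) c (x @\<^sub>v u) \<longleftrightarrow> u = g x))"
    by auto
  thus ?thesis using sum by (intro exI[of _ V'] exI[of _ g]) auto
qed

definition stage_cost :: "lq_problem \<Rightarrow> nat \<Rightarrow> real vec \<Rightarrow> real vec \<Rightarrow> real" where
  "stage_cost P k x u = quad (stage_weight P k) (qw P k @\<^sub>v rw P k) 0 (x @\<^sub>v u)"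

definition terminal_cost :: "lq_problem \<Rightarrow> real vec \<Rightarrow> real" where
  "terminal_cost P = quad (Qw P (horizon P)) (qw P (horizon P)) 0"

lemma lq_cost_eq:
  "lq_cost P x u = (\<Sum>k<horizon P. stage_cost P k (x k) (u k)) + terminal_cost P (x (horizon P))"
  by (simp add: lq_cost_def stage_cost_def terminal_cost_def quad_def)

lemma stage_weight_form:
  assumes Q: "Qw P k \<in> carrier_mat n n" and R: "Rw P k \<in> carrier_mat m m"
    and S: "Sw P k \<in> carrier_mat m n" and x: "x \<in> carrier_vec n" and u: "u \<in> carrier_vec m"
  shows "(x @\<^sub>v u) \<bullet> (stage_weight P k *\<^sub>v (x @\<^sub>v u)) =
    x \<bullet> (Qw P k *\<^sub>v x) + 2 * (u \<bullet> (Sw P k *\<^sub>v x)) + u \<bullet> (Rw P k *\<^sub>v u)"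
proof -
  have ST: "transpose_mat (Sw P k) \<in> carrier_mat n m" using S by simp
  have "x \<bullet> (transpose_mat (Sw P k) *\<^sub>v u) = (Sw P k *\<^sub>v x) \<bullet> u"
    by (rule mult_mat_vec_scalar_prod[OF S x u, symmetric])
  also have "\<dots> = u \<bullet> (Sw P k *\<^sub>v x)" using S x u by (intro comm_scalar_prod[of _ m]) auto
  finally have cross: "x \<bullet> (transpose_mat (Sw P k) *\<^sub>v u) = u \<bullet> (Sw P k *\<^sub>v x)" .
  show ?thesis
    unfolding stage_weight_def four_block_mat_mult_vec[OF Q ST S R x u]
    using Q R S ST x u cross
    by (simp add: scalar_prod_append[of _ n _ m] scalar_prod_add_distrib[of _ n] scalar_prod_add_distrib[of _ m])
qed

text \<open>The Bellman equation in the form in which verification uses it: \<open>V k\<close> bounds the cost of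
  every input from below, and the bound is attained by the feedback \<open>g k\<close> only.\<close>

lemma value_functions_exist:
  assumes data: "lq_data n m P" and convex: "lq_convex n m P"
  shows "\<exists>V g. (\<forall>x \<in> carrier_vec n. V (horizon P) x = terminal_cost P x) \<and>
    (\<forall>k < horizon P. \<forall>x \<in> carrier_vec n. g k x \<in> carrier_vec m \<and> (\<forall>u \<in> carrier_vec m.
      V k x \<le> stage_cost P k x u + V (Suc k) (Amat P *\<^sub>v x + Bmat P *\<^sub>v u + offset P k) \<and>
      (V k x = stage_cost P k x u + V (Suc k) (Amat P *\<^sub>v x + Bmat P *\<^sub>v u + offset P k)
        \<longleftrightarrow> u = g k x)))"
proof -
  let ?N = "horizon P"
  define Bellman where "Bellman = (\<lambda>k V' V g. \<forall>x \<in> carrier_vec n. g x \<in> carrier_vec m \<and>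
      (\<forall>u \<in> carrier_vec m.
        V x \<le> stage_cost P k x u + V' (Amat P *\<^sub>v x + Bmat P *\<^sub>v u + offset P k) \<and>
        (V x = stage_cost P k x u + V' (Amat P *\<^sub>v x + Bmat P *\<^sub>v u + offset P k) \<longleftrightarrow> u = g x)))"
  have step: "\<exists>V g. convex_quadratic n V \<and> Bellman k V' V g"
    if k: "k < ?N" and V': "convex_quadratic n V'" for k V'
  proof -
    have S: "Sw P k \<in> carrier_mat m n" and Q: "Qw P k \<in> carrier_mat n n"
      and R: "Rw P k \<in> carrier_mat m m"
      using data k by (auto simp: lq_data_def symmetric_real_mat_def)
    have "0 < (0\<^sub>v n @\<^sub>v d) \<bullet> (stage_weight P k *\<^sub>v (0\<^sub>v n @\<^sub>v d))"
      if d: "d \<in> carrier_vec m" "d \<noteq> 0\<^sub>v m" for d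
    proof -
      have "0 < d \<bullet> (Rw P k *\<^sub>v d)" using convex k d by (simp add: lq_convex_def pos_def_def)
      thus ?thesis using stage_weight_form[OF Q R S zero_carrier_vec d(1)]
          mult_mat_vec_zero[OF Q] mult_mat_vec_zero[OF S] d by simp
    qed
    thus ?thesis
      unfolding Bellman_def stage_cost_def
      using data convex k V' by (intro bellman_step) (auto simp: lq_data_def lq_convex_def)
  qed
  \<comment> \<open>\<open>f i\<close> is the value function with \<open>i\<close> stages to go.\<close>
  have "\<exists>f. \<forall>i. (convex_quadratic n (f i) \<and> (i = 0 \<longrightarrow> f i = terminal_cost P)) \<and>
      (i < ?N \<longrightarrow> (\<exists>g. Bellman (?N - Suc i) (f i) (f (Suc i)) g))"
  proof (rule dependent_nat_choice)
    have "convex_quadratic n (terminal_cost P)"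
      using data convex by (auto simp: lq_data_def lq_convex_def convex_quadratic_def terminal_cost_def)
    thus "\<exists>V. convex_quadratic n V \<and> ((0::nat) = 0 \<longrightarrow> V = terminal_cost P)" by blast
  next
    fix V' and i :: nat
    assume V': "convex_quadratic n V' \<and> (i = 0 \<longrightarrow> V' = terminal_cost P)"
    show "\<exists>V. (convex_quadratic n V \<and> (Suc i = 0 \<longrightarrow> V = terminal_cost P)) \<and>
        (i < ?N \<longrightarrow> (\<exists>g. Bellman (?N - Suc i) V' V g))"
      using step[of "?N - Suc i" V'] V' by (cases "i < ?N") auto
  qed
  then obtain f where f0: "f 0 = terminal_cost P"
    and f: "\<And>i. i < ?N \<Longrightarrow> \<exists>g. Bellman (?N - Suc i) (f i) (f (Suc i)) g" by blast
  have "\<exists>g. Bellman k (f (?N - Suc k)) (f (?N - k)) g" if "k < ?N" for k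
    using f[of "?N - Suc k"] that by (simp add: Suc_diff_Suc)
  then obtain g where "\<And>k. k < ?N \<Longrightarrow> Bellman k (f (?N - Suc k)) (f (?N - k)) (g k)" by metis
  thus ?thesis
    unfolding Bellman_def using f0 by (intro exI[of _ "\<lambda>k. f (?N - k)"] exI[of _ g]) simp
qed

text \<open>Telescoping the value functions along a trajectory writes its cost as \<open>V 0\<close> at the initial
  state plus the sum of the stagewise gaps in the Bellman inequality. All gaps vanish precisely
  for the closed loop under \<open>g\<close>, whose trajectory is determined by the initial state.\<close>

lemma lq_solution_exists:
  assumes data: "lq_data n m P" and convex: "lq_convex n m P"
  shows "\<exists>x u. lq_solution P x u"
proof -
  let ?N = "horizon P"
  let ?next = "\<lambda>k x u. Amat P *\<^sub>v x + Bmat P *\<^sub>v u + offset P k"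
  obtain V g where VN: "\<And>x. x \<in> carrier_vec n \<Longrightarrow> V ?N x = terminal_cost P x"
    and g: "\<And>k x. k < ?N \<Longrightarrow> x \<in> carrier_vec n \<Longrightarrow> g k x \<in> carrier_vec m"
    and le: "\<And>k x u. k < ?N \<Longrightarrow> x \<in> carrier_vec n \<Longrightarrow> u \<in> carrier_vec m \<Longrightarrow>
        V k x \<le> stage_cost P k x u + V (Suc k) (?next k x u)"
    and eq: "\<And>k x u. k < ?N \<Longrightarrow> x \<in> carrier_vec n \<Longrightarrow> u \<in> carrier_vec m \<Longrightarrow>
        V k x = stage_cost P k x u + V (Suc k) (?next k x u) \<longleftrightarrow> u = g k x"
    using value_functions_exist[OF data convex] by blast
  have A: "Amat P \<in> carrier_mat n n" and B: "Bmat P \<in> carrier_mat n m"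
    and init: "init P \<in> carrier_vec n" and off: "\<And>k. k < ?N \<Longrightarrow> offset P k \<in> carrier_vec n"
    using data by (auto simp: lq_data_def)
  have feas: "x k \<in> carrier_vec n" "k < ?N \<Longrightarrow> u k \<in> carrier_vec m" "x 0 = init P"
    "k < ?N \<Longrightarrow> x (Suc k) = ?next k (x k) (u k)" if "lq_feasible P x u" "k \<le> ?N" for x u k
    using that A B by (auto simp: lq_feasible_def)
  define loss where "loss = (\<lambda>x u k. stage_cost P k (x k) (u k) + V (Suc k) (x (Suc k)) - V k (x k))"
  have loss: "0 \<le> loss x u k" "loss x u k = 0 \<longleftrightarrow> u k = g k (x k)"
    if "lq_feasible P x u" "k < ?N" for x u k
    using le[of k "x k" "u k"] eq[of k "x k" "u k"] feas[OF that(1), of k] that(2)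
    by (auto simp: loss_def)
  have cost: "lq_cost P x u = V 0 (init P) + (\<Sum>k<?N. loss x u k)" if "lq_feasible P x u" for x u
  proof -
    have "(\<Sum>k<?N. loss x u k) = (\<Sum>k<?N. stage_cost P k (x k) (u k)) +
        (\<Sum>k<?N. V (Suc k) (x (Suc k)) - V k (x k))"
      by (simp add: loss_def sum.distrib[symmetric] algebra_simps)
    also have "(\<Sum>k<?N. V (Suc k) (x (Suc k)) - V k (x k)) = V ?N (x ?N) - V 0 (x 0)"
      by (rule sum_lessThan_telescope)
    finally show ?thesis
      using VN[of "x ?N"] feas[OF that, of ?N] by (simp add: lq_cost_eq)
  qed
  define x where "x = rec_nat (init P) (\<lambda>k y. ?next k y (g k y))"
  define u where "u = (\<lambda>k. g k (x k))"
  have x0: "x 0 = init P" and xS: "\<And>k. x (Suc k) = ?next k (x k) (u k)"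
    by (simp_all add: x_def u_def)
  have "x k \<in> carrier_vec n" if "k \<le> ?N" for k
    using that
  proof (induction k)
    case (Suc k)
    thus ?case using A B off[of k] g[of k "x k"] by (simp add: xS u_def)
  qed (simp add: x0 init)
  hence opt: "lq_feasible P x u"
    using A B g x0 xS by (simp add: lq_feasible_def u_def)
  have "(\<Sum>k<?N. loss x u k) = 0"
    using loss(2)[OF opt] by (intro sum.neutral) (auto simp: u_def)
  hence cost_opt: "lq_cost P x u = V 0 (init P)" by (simp add: cost[OF opt])
  have "lq_minimizer P x u"
    using opt cost cost_opt loss(1) by (auto simp: lq_minimizer_def intro!: sum_nonneg)
  moreover have "(\<forall>k \<le> ?N. x' k = x k) \<and> (\<forall>k < ?N. u' k = u k)" if min: "lq_minimizer P x' u'" for x' u'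
  proof -
    have F: "lq_feasible P x' u'" and "lq_cost P x' u' \<le> lq_cost P x u"
      using min opt by (auto simp: lq_minimizer_def)
    hence "(\<Sum>k<?N. loss x' u' k) \<le> 0" by (simp add: cost[OF F] cost_opt)
    moreover have "0 \<le> (\<Sum>k<?N. loss x' u' k)" using loss(1)[OF F] by (auto intro!: sum_nonneg)
    ultimately have "(\<Sum>k<?N. loss x' u' k) = 0" by simp
    hence u': "u' k = g k (x' k)" if "k < ?N" for k
      using that loss[OF F] by (subst (asm) sum_nonneg_eq_0_iff) auto
    have x': "x' k = x k" if "k \<le> ?N" for k
      using that
    proof (induction k)
      case 0
      thus ?case using feas(3)[OF F, of 0] x0 by simp
    next
      case (Suc k)
      thus ?case using feas(4)[OF F, of k] u'[of k] by (simp add: xS u_def)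
    qed
    with u' show ?thesis by (simp add: u_def)
  qed
  ultimately show ?thesis unfolding lq_solution_def by blast
qed



section \<open>Transfer of solutions along a cost-preserving correspondence\<close>

text \<open>Trajectories are functions on all of \<open>nat\<close>, so a change of coordinates is a bijection only up
  to values outside the horizon. A relation \<open>r\<close> accommodates this; the lemma is applied to a
  relation and to its converse. Totality reaches every competitor in \<open>P'\<close>, and single-valuedness
  carries uniqueness over.\<close>

lemma lq_solution_transfer:
  assumes horizon: "horizon P' = horizon P"
    and feas: "\<And>x u z v. r x u z v \<Longrightarrow> lq_feasible P x u \<longleftrightarrow> lq_feasible P' z v"
    and cost: "\<And>x u z v. r x u z v \<Longrightarrow> lq_cost P x u = lq_cost P' z v"
    and total: "\<And>z v. lq_feasible P' z v \<Longrightarrow> \<exists>x u. r x u z v"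
    and single_valued: "\<And>x u z v x' u' z' v'. r x u z v \<Longrightarrow> r x' u' z' v' \<Longrightarrow>
        \<forall>k \<le> horizon P. x' k = x k \<Longrightarrow> \<forall>k < horizon P. u' k = u k \<Longrightarrow>
        (\<forall>k \<le> horizon P. z' k = z k) \<and> (\<forall>k < horizon P. v' k = v k)"
    and sol: "lq_solution P x u" and r: "r x u z v"
  shows "lq_solution P' z v"
proof -
  have F: "lq_feasible P x u"
    and min: "\<And>x' u'. lq_feasible P x' u' \<Longrightarrow> lq_cost P x u \<le> lq_cost P x' u'"
    and unique: "\<And>x' u'. lq_minimizer P x' u' \<Longrightarrow>
        (\<forall>k \<le> horizon P. x' k = x k) \<and> (\<forall>k < horizon P. u' k = u k)"
    using sol by (auto simp: lq_solution_def lq_minimizer_def)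
  have opt: "lq_minimizer P' z v"
    unfolding lq_minimizer_def using F feas[OF r] cost[OF r] min total feas cost by metis
  moreover have "(\<forall>k \<le> horizon P. z' k = z k) \<and> (\<forall>k < horizon P. v' k = v k)"
    if min': "lq_minimizer P' z' v'" for z' v'
  proof -
    have F': "lq_feasible P' z' v'" and le: "lq_cost P' z' v' \<le> lq_cost P' z v"
      using min' opt by (auto simp: lq_minimizer_def)
    obtain x' u' where r': "r x' u' z' v'" using total[OF F'] by blast
    have "lq_minimizer P x' u'"
      using F' le feas[OF r'] cost[OF r'] cost[OF r] min by (fastforce simp: lq_minimizer_def)
    thus ?thesis using single_valued[OF r r'] unique by blast
  qed
  ultimately show ?thesis by (simp add: lq_solution_def horizon)
qed


section \<open>Change of coordinates and feedback\<close>

locale feedback_transformation =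
  fixes n m :: nat and P :: lq_problem and T F G :: "real mat"
  assumes T: "T \<in> carrier_mat n n" "invertible_mat T"
    and G: "G \<in> carrier_mat m m" "invertible_mat G"
    and F: "F \<in> carrier_mat m n"
    and data: "lq_data n m P"
begin

abbreviation transformed :: lq_problem where
  "transformed \<equiv> brunovsky_problem (T * (Amat P + Bmat P * F) * mat_inv T) (T * Bmat P * G) T F G P"

definition corresponds ::
    "(nat \<Rightarrow> real vec) \<Rightarrow> (nat \<Rightarrow> real vec) \<Rightarrow> (nat \<Rightarrow> real vec) \<Rightarrow> (nat \<Rightarrow> real vec) \<Rightarrow> bool" where
  "corresponds x u z v \<longleftrightarrow>
     (\<forall>k \<le> horizon P. z k \<in> carrier_vec n \<and> x k = mat_inv T *\<^sub>v z k) \<and>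
     (\<forall>k < horizon P. v k \<in> carrier_vec m \<and> u k = F *\<^sub>v x k + G *\<^sub>v v k)"

lemmas Ti = mat_inv_invertible[OF T]
lemmas Gi = mat_inv_invertible[OF G]

lemma T_cancel: "w \<in> carrier_vec n \<Longrightarrow> T *\<^sub>v (mat_inv T *\<^sub>v w) = w"
  "w \<in> carrier_vec n \<Longrightarrow> mat_inv T *\<^sub>v (T *\<^sub>v w) = w"
  using assoc_mult_mat_vec[OF T(1) Ti(1)] assoc_mult_mat_vec[OF Ti(1) T(1)] Ti by force+

lemma G_cancel: "w \<in> carrier_vec m \<Longrightarrow> G *\<^sub>v (mat_inv G *\<^sub>v w) = w"
  "w \<in> carrier_vec m \<Longrightarrow> mat_inv G *\<^sub>v (G *\<^sub>v w) = w"
  using assoc_mult_mat_vec[OF G(1) Gi(1)] assoc_mult_mat_vec[OF Gi(1) G(1)] Gi by force+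

lemma data_carrier:
  "Amat P \<in> carrier_mat n n" "Bmat P \<in> carrier_mat n m" "init P \<in> carrier_vec n"
  "k < horizon P \<Longrightarrow> offset P k \<in> carrier_vec n"
  using data by (auto simp: lq_data_def)

lemma dynamics_transformed:
  assumes z: "z \<in> carrier_vec n" and v: "v \<in> carrier_vec m" and b: "b \<in> carrier_vec n"
    and x: "x = mat_inv T *\<^sub>v z" and u: "u = F *\<^sub>v x + G *\<^sub>v v"
  shows "(T * (Amat P + Bmat P * F) * mat_inv T) *\<^sub>v z + (T * Bmat P * G) *\<^sub>v v + T *\<^sub>v b =
    T *\<^sub>v (Amat P *\<^sub>v x + Bmat P *\<^sub>v u + b)"
proof -
  note A = data_carrier(1) and B = data_carrier(2)
  have xC: "x \<in> carrier_vec n" using x Ti(1) z by simp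
  have "(T * (Amat P + Bmat P * F) * mat_inv T) *\<^sub>v z = T *\<^sub>v (Amat P *\<^sub>v x + Bmat P *\<^sub>v (F *\<^sub>v x))"
    using T(1) Ti(1) A B F z xC
    by (simp add: x assoc_mult_mat_vec[of _ n n _ n] add_mult_distrib_mat_vec[of _ n n]
        assoc_mult_mat_vec[of _ n m _ n])
  moreover have "(T * Bmat P * G) *\<^sub>v v = T *\<^sub>v (Bmat P *\<^sub>v (G *\<^sub>v v))"
    using T(1) B G(1) v by (simp add: assoc_mult_mat_vec[of _ n m _ m] assoc_mult_mat_vec[of _ n n _ m])
  moreover have "Amat P *\<^sub>v x + Bmat P *\<^sub>v u + b =
      (Amat P *\<^sub>v x + Bmat P *\<^sub>v (F *\<^sub>v x)) + Bmat P *\<^sub>v (G *\<^sub>v v) + b"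
    using A B F G(1) xC v
    by (simp add: u mult_add_distrib_mat_vec[of _ n m] assoc_add_vec[of _ n])
  ultimately show ?thesis
    using T(1) A B F G(1) xC v b by (simp add: mult_add_distrib_mat_vec[OF T(1)])
qed

lemma corresponds_feasible:
  assumes c: "corresponds x u z v"
  shows "lq_feasible P x u \<longleftrightarrow> lq_feasible transformed z v"
proof -
  note A = data_carrier(1) and B = data_carrier(2)
  have zC: "z k \<in> carrier_vec n" and xk: "x k = mat_inv T *\<^sub>v z k" if "k \<le> horizon P" for k
    using c that by (auto simp: corresponds_def)
  have vC: "v k \<in> carrier_vec m" and uk: "u k = F *\<^sub>v x k + G *\<^sub>v v k" if "k < horizon P" for k
    using c that by (auto simp: corresponds_def)
  have xC: "x k \<in> carrier_vec n" if "k \<le> horizon P" for k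
    using xk zC that Ti(1) by simp
  have uC: "u k \<in> carrier_vec m" if "k < horizon P" for k
    using uk vC xC[of k] that F G(1) by simp
  have T_iff: "mat_inv T *\<^sub>v a = w \<longleftrightarrow> a = T *\<^sub>v w" if "a \<in> carrier_vec n" "w \<in> carrier_vec n" for a w
    using T_cancel that by metis
  have "x 0 = init P \<longleftrightarrow> z 0 = T *\<^sub>v init P"
    using xk zC T_iff data_carrier(3) by simp
  moreover have "x (Suc k) = Amat P *\<^sub>v x k + Bmat P *\<^sub>v u k + offset P k \<longleftrightarrow>
      z (Suc k) = (T * (Amat P + Bmat P * F) * mat_inv T) *\<^sub>v z k + (T * Bmat P * G) *\<^sub>v v k
        + T *\<^sub>v offset P k" if k: "k < horizon P" for k
    unfolding dynamics_transformed[OF zC vC data_carrier(4) xk uk, OF less_imp_le[OF k] k k less_imp_le[OF k] k]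
    using k xk[of "Suc k"] T_iff[OF zC[of "Suc k"]] A B xC[of k] uC[of k] data_carrier(4)[of k]
    by (simp add: Suc_leI)
  ultimately show ?thesis
    using xC uC zC vC A B T(1) G(1) Ti(1)
    by (auto simp: lq_feasible_def brunovsky_problem_def)
qed

text \<open>With \<open>a = F x\<close> and \<open>w = G v\<close>, both sides equal the quadratic form of the original stage
  weight at \<open>(x, a + w)\<close>: moving the transposed factors \<open>T\<inverse>\<close>, \<open>F\<close> and \<open>G\<close> across the scalar
  products turns the transformed weights into scalar products of \<open>x\<close>, \<open>a\<close> and \<open>w\<close> with the
  original ones, and the symmetry of \<open>R\<close> merges the two mixed terms in \<open>a\<close> and \<open>w\<close>.\<close>

lemma stage_cost_transformed:
  assumes k: "k < horizon P" and z: "z \<in> carrier_vec n" and v: "v \<in> carrier_vec m"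
    and x: "x = mat_inv T *\<^sub>v z"
  shows "stage_cost transformed k z v = stage_cost P k x (F *\<^sub>v x + G *\<^sub>v v)"
proof -
  define Q R S q r where "Q = Qw P k" "R = Rw P k" "S = Sw P k" "q = qw P k" "r = rw P k"
  note defs = this
  define a w where "a = F *\<^sub>v x" "w = G *\<^sub>v v"
  note aw = this
  have Rsym: "symmetric_real_mat m R"
    and C: "Q \<in> carrier_mat n n" "R \<in> carrier_mat m m" "S \<in> carrier_mat m n"
      "q \<in> carrier_vec n" "r \<in> carrier_vec m"
    using data k by (auto simp: lq_data_def symmetric_real_mat_def defs)
  have xC: "x \<in> carrier_vec n" using x z Ti(1) by simp
  have aC: "a \<in> carrier_vec m" and wC: "w \<in> carrier_vec m" using xC v F G(1) by (auto simp: aw)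
  let ?Q = "Q + transpose_mat F * R * F + (transpose_mat F * S + transpose_mat S * F)"
  have QC: "?Q \<in> carrier_mat n n" using C F by simp
  have TT: "z \<bullet> (transpose_mat (mat_inv T) *\<^sub>v y) = x \<bullet> y" if "y \<in> carrier_vec n" for y
    unfolding x using mult_mat_vec_scalar_prod[OF Ti(1) z that] by simp
  have GG: "v \<bullet> (transpose_mat G *\<^sub>v y) = w \<bullet> y" if "y \<in> carrier_vec m" for y
    unfolding aw using mult_mat_vec_scalar_prod[OF G(1) v that] by simp
  have FF: "x \<bullet> (transpose_mat F *\<^sub>v y) = a \<bullet> y" if "y \<in> carrier_vec m" for y
    unfolding aw using mult_mat_vec_scalar_prod[OF F xC that] by simp
  have SS: "x \<bullet> (transpose_mat S *\<^sub>v a) = a \<bullet> (S *\<^sub>v x)"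
    using mult_mat_vec_scalar_prod[OF C(3) xC aC] comm_scalar_prod[OF aC, of "S *\<^sub>v x"] C xC by simp
  have zz: "z \<bullet> ((transpose_mat (mat_inv T) * ?Q * mat_inv T) *\<^sub>v z) =
      x \<bullet> (Q *\<^sub>v x) + a \<bullet> (R *\<^sub>v a) + 2 * (a \<bullet> (S *\<^sub>v x))"
  proof -
    have "(transpose_mat (mat_inv T) * ?Q * mat_inv T) *\<^sub>v z = transpose_mat (mat_inv T) *\<^sub>v (?Q *\<^sub>v x)"
      unfolding x using QC Ti(1) z by (simp add: assoc_mult_mat_vec[of _ n n _ n])
    moreover have "?Q *\<^sub>v x = Q *\<^sub>v x + transpose_mat F *\<^sub>v (R *\<^sub>v a)
        + (transpose_mat F *\<^sub>v (S *\<^sub>v x) + transpose_mat S *\<^sub>v a)"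
      using C F xC by (simp add: aw add_mult_distrib_mat_vec[of _ n n] assoc_mult_mat_vec[of _ n m _ n]
          assoc_mult_mat_vec[of _ n m _ m] assoc_add_vec[of _ n])
    ultimately show ?thesis
      using C F xC aC QC TT[of "?Q *\<^sub>v x"]
      by (simp add: scalar_prod_add_distrib[of _ n] FF SS)
  qed
  have vz: "v \<bullet> ((transpose_mat G * (S + R * F) * mat_inv T) *\<^sub>v z) = w \<bullet> (S *\<^sub>v x) + w \<bullet> (R *\<^sub>v a)"
  proof -
    have "(transpose_mat G * (S + R * F) * mat_inv T) *\<^sub>v z = transpose_mat G *\<^sub>v (S *\<^sub>v x + R *\<^sub>v a)"
      unfolding x aw using C F G(1) Ti(1) z
      by (simp add: assoc_mult_mat_vec[of _ m n _ n] assoc_mult_mat_vec[of _ m m _ n] add_mult_distrib_mat_vec[of _ m n])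
    thus ?thesis using C xC aC wC GG[of "S *\<^sub>v x + R *\<^sub>v a"] by (simp add: scalar_prod_add_distrib[of _ m])
  qed
  have vv: "v \<bullet> ((transpose_mat G * R * G) *\<^sub>v v) = w \<bullet> (R *\<^sub>v w)"
  proof -
    have "(transpose_mat G * R * G) *\<^sub>v v = transpose_mat G *\<^sub>v (R *\<^sub>v w)"
      unfolding aw using C G(1) v by (simp add: assoc_mult_mat_vec[of _ m m _ m])
    thus ?thesis using GG[of "R *\<^sub>v w"] C wC by simp
  qed
  have zq: "z \<bullet> (transpose_mat (mat_inv T) *\<^sub>v (q + transpose_mat F *\<^sub>v r)) = x \<bullet> q + a \<bullet> r"
    using TT[of "q + transpose_mat F *\<^sub>v r"] C F xC by (simp add: scalar_prod_add_distrib[of _ n] FF)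
  have vr: "v \<bullet> (transpose_mat G *\<^sub>v r) = w \<bullet> r" by (rule GG[OF C(5)])
  have aw_sym: "a \<bullet> (R *\<^sub>v w) = w \<bullet> (R *\<^sub>v a)" by (rule symmetric_scalar_prod[OF Rsym aC wC])
  have form: "(z @\<^sub>v v) \<bullet> (stage_weight transformed k *\<^sub>v (z @\<^sub>v v)) =
      z \<bullet> (Qw transformed k *\<^sub>v z) + 2 * (v \<bullet> (Sw transformed k *\<^sub>v z)) + v \<bullet> (Rw transformed k *\<^sub>v v)"
    using C F G(1) Ti(1) QC k
    by (intro stage_weight_form) (auto simp: brunovsky_problem_def defs z v)
  have form': "(x @\<^sub>v (a + w)) \<bullet> (stage_weight P k *\<^sub>v (x @\<^sub>v (a + w))) =
      x \<bullet> (Qw P k *\<^sub>v x) + 2 * ((a + w) \<bullet> (Sw P k *\<^sub>v x)) + (a + w) \<bullet> (Rw P k *\<^sub>v (a + w))"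
    using C xC aC wC by (intro stage_weight_form) (auto simp: defs)
  have "(z @\<^sub>v v) \<bullet> (qw transformed k @\<^sub>v rw transformed k) = x \<bullet> q + a \<bullet> r + w \<bullet> r"
    using zq vr k z v C Ti(1) F G(1)
    by (simp add: brunovsky_problem_def defs scalar_prod_append[of _ n _ m])
  moreover have "(z @\<^sub>v v) \<bullet> (stage_weight transformed k *\<^sub>v (z @\<^sub>v v)) =
      x \<bullet> (Q *\<^sub>v x) + a \<bullet> (R *\<^sub>v a) + 2 * (a \<bullet> (S *\<^sub>v x)) + 2 * (w \<bullet> (S *\<^sub>v x))
        + 2 * (w \<bullet> (R *\<^sub>v a)) + w \<bullet> (R *\<^sub>v w)"
    unfolding form using zz vz vv k by (simp add: brunovsky_problem_def defs)
  moreover have "(x @\<^sub>v (a + w)) \<bullet> (q @\<^sub>v r) = x \<bullet> q + a \<bullet> r + w \<bullet> r"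
    using C xC aC wC by (simp add: scalar_prod_append[of _ n _ m] add_scalar_prod_distrib[of _ m])
  moreover have "(x @\<^sub>v (a + w)) \<bullet> (stage_weight P k *\<^sub>v (x @\<^sub>v (a + w))) =
      x \<bullet> (Q *\<^sub>v x) + a \<bullet> (R *\<^sub>v a) + 2 * (a \<bullet> (S *\<^sub>v x)) + 2 * (w \<bullet> (S *\<^sub>v x))
        + 2 * (w \<bullet> (R *\<^sub>v a)) + w \<bullet> (R *\<^sub>v w)"
    unfolding form' defs[symmetric] using C xC aC wC aw_sym
    by (simp add: add_scalar_prod_distrib[of _ m] mult_add_distrib_mat_vec[of _ m m] scalar_prod_add_distrib[of _ m])
  ultimately show ?thesis
    unfolding stage_cost_def quad_def aw[symmetric] by (simp add: defs)
qed

lemma terminal_cost_transformed: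
  assumes z: "z \<in> carrier_vec n"
  shows "terminal_cost transformed z = terminal_cost P (mat_inv T *\<^sub>v z)"
proof -
  have C: "Qw P (horizon P) \<in> carrier_mat n n" "qw P (horizon P) \<in> carrier_vec n"
    using data by (auto simp: lq_data_def symmetric_real_mat_def)
  have TT: "z \<bullet> (transpose_mat (mat_inv T) *\<^sub>v y) = (mat_inv T *\<^sub>v z) \<bullet> y" if "y \<in> carrier_vec n" for y
    using mult_mat_vec_scalar_prod[OF Ti(1) z that] by simp
  show ?thesis
    using C Ti(1) z
    by (simp add: terminal_cost_def quad_def brunovsky_problem_def TT assoc_mult_mat_vec[of _ n n _ n])
qed

lemma corresponds_cost:
  assumes "corresponds x u z v"
  shows "lq_cost P x u = lq_cost transformed z v"
proof -
  have "horizon transformed = horizon P" by (simp add: brunovsky_problem_def)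
  thus ?thesis
    using assms stage_cost_transformed terminal_cost_transformed
    by (auto simp: lq_cost_eq corresponds_def intro!: sum.cong)
qed

text \<open>The correspondence is one-to-one on the horizon because \<open>T\<close> and \<open>G\<close> are injective.\<close>

lemma corresponds_determined:
  assumes "corresponds x u z v" "corresponds x' u' z' v'"
  shows "((\<forall>k \<le> horizon P. x' k = x k) \<and> (\<forall>k < horizon P. u' k = u k)) \<longleftrightarrow>
    ((\<forall>k \<le> horizon P. z' k = z k) \<and> (\<forall>k < horizon P. v' k = v k))"
proof -
  have x: "x' k = x k \<longleftrightarrow> z' k = z k" if "k \<le> horizon P" for k
    using assms that T_cancel unfolding corresponds_def by metis
  have "u' k = u k \<longleftrightarrow> v' k = v k" if k: "k < horizon P" and eq: "x' k = x k" for k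
  proof -
    have C: "v k \<in> carrier_vec m" "v' k \<in> carrier_vec m" "F *\<^sub>v x k \<in> carrier_vec m"
      and u: "u k = F *\<^sub>v x k + G *\<^sub>v v k" "u' k = F *\<^sub>v x k + G *\<^sub>v v' k"
      using assms k eq F Ti(1) by (auto simp: corresponds_def)
    have "u' k = u k \<longleftrightarrow> G *\<^sub>v v' k = G *\<^sub>v v k"
      unfolding u using C G(1) by (auto simp: vec_eq_iff)
    also have "\<dots> \<longleftrightarrow> v' k = v k" using G_cancel C by metis
    finally show ?thesis .
  qed
  with x show ?thesis by auto
qed

lemma corresponds_original:
  assumes "lq_feasible P x u"
  shows "corresponds x u (\<lambda>k. T *\<^sub>v x k) (\<lambda>k. mat_inv G *\<^sub>v (u k - F *\<^sub>v x k))"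
proof -
  have x: "\<And>k. k \<le> horizon P \<Longrightarrow> x k \<in> carrier_vec n" and u: "\<And>k. k < horizon P \<Longrightarrow> u k \<in> carrier_vec m"
    using assms data_carrier by (auto simp: lq_feasible_def)
  have "F *\<^sub>v y + (w - F *\<^sub>v y) = w" if "y \<in> carrier_vec n" "w \<in> carrier_vec m" for y w
    using F that by (intro eq_vecI) auto
  thus ?thesis
    using x u F T(1) Gi(1) by (simp add: corresponds_def T_cancel G_cancel)
qed

lemma corresponds_transformed:
  assumes "lq_feasible transformed z v"
  shows "corresponds (\<lambda>k. mat_inv T *\<^sub>v z k) (\<lambda>k. F *\<^sub>v (mat_inv T *\<^sub>v z k) + G *\<^sub>v v k) z v"
  using assms T(1) G(1) by (auto simp: lq_feasible_def brunovsky_problem_def corresponds_def)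

lemma solution_to_transformed:
  assumes "lq_solution P x u"
  shows "lq_solution transformed (\<lambda>k. T *\<^sub>v x k) (\<lambda>k. mat_inv G *\<^sub>v (u k - F *\<^sub>v x k))"
proof (rule lq_solution_transfer[where r = corresponds, OF _ corresponds_feasible corresponds_cost _ _ assms])
  show "horizon transformed = horizon P" by (simp add: brunovsky_problem_def)
  show "corresponds x u (\<lambda>k. T *\<^sub>v x k) (\<lambda>k. mat_inv G *\<^sub>v (u k - F *\<^sub>v x k))"
    using assms by (intro corresponds_original) (simp add: lq_solution_def lq_minimizer_def)
qed (use corresponds_transformed corresponds_determined in blast)+

lemma solution_from_transformed:
  assumes "lq_solution transformed z v"
  shows "lq_solution P (\<lambda>k. mat_inv T *\<^sub>v z k) (\<lambda>k. F *\<^sub>v (mat_inv T *\<^sub>v z k) + G *\<^sub>v v k)"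
proof (rule lq_solution_transfer[where r = "\<lambda>z v x u. corresponds x u z v", OF _ _ _ _ _ assms])
  show h: "horizon P = horizon transformed" by (simp add: brunovsky_problem_def)
  show "corresponds (\<lambda>k. mat_inv T *\<^sub>v z k) (\<lambda>k. F *\<^sub>v (mat_inv T *\<^sub>v z k) + G *\<^sub>v v k) z v"
    using assms by (intro corresponds_transformed) (simp add: lq_solution_def lq_minimizer_def)
  fix z v x u z' v' x' u'
  assume c: "corresponds x u z v" "corresponds x' u' z' v'"
    and "\<forall>k \<le> horizon transformed. z' k = z k" "\<forall>k < horizon transformed. v' k = v k"
  thus "(\<forall>k \<le> horizon transformed. x' k = x k) \<and> (\<forall>k < horizon transformed. u' k = u k)"
    using corresponds_determined[OF c] unfolding h[symmetric] by blast
qed (use corresponds_feasible corresponds_cost[symmetric] corresponds_original in blast)+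

end

theorem proposition2:
  fixes n n\<^sub>u :: nat
    and A\<^sub>b B\<^sub>b T\<^sub>j\<^sub>o F\<^sub>d\<^sub>b G :: "real mat"
    and P :: lq_problem
  assumes "controllable_pair n n\<^sub>u (Amat P) (Bmat P)"
    and "T\<^sub>j\<^sub>o \<in> carrier_mat n n" and "invertible_mat T\<^sub>j\<^sub>o"
    and "G \<in> carrier_mat n\<^sub>u n\<^sub>u" and "invertible_mat G"
    and "F\<^sub>d\<^sub>b \<in> carrier_mat n\<^sub>u n"
    and "A\<^sub>b = T\<^sub>j\<^sub>o * (Amat P + Bmat P * F\<^sub>d\<^sub>b) * mat_inv T\<^sub>j\<^sub>o"
    and "B\<^sub>b = T\<^sub>j\<^sub>o * Bmat P * G"
    and "brunovsky_form n n\<^sub>u A\<^sub>b B\<^sub>b"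
    and "lq_data n n\<^sub>u P"
    and "lq_convex n n\<^sub>u P"
  shows "(\<exists>z v. lq_solution (brunovsky_problem A\<^sub>b B\<^sub>b T\<^sub>j\<^sub>o F\<^sub>d\<^sub>b G P) z v) \<and>
    (\<forall>z v. lq_solution (brunovsky_problem A\<^sub>b B\<^sub>b T\<^sub>j\<^sub>o F\<^sub>d\<^sub>b G P) z v \<longrightarrow>
       lq_solution P
         (\<lambda>k. mat_inv T\<^sub>j\<^sub>o *\<^sub>v z k)
         (\<lambda>k. F\<^sub>d\<^sub>b *\<^sub>v (mat_inv T\<^sub>j\<^sub>o *\<^sub>v z k) + G *\<^sub>v v k))"
proof -
  interpret feedback_transformation n n\<^sub>u P T\<^sub>j\<^sub>o F\<^sub>d\<^sub>b G
    using assms by unfold_locales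
  obtain x u where "lq_solution P x u" using lq_solution_exists assms(10,11) by blast
  with solution_to_transformed solution_from_transformed show ?thesis
    unfolding assms(7,8) by blast
qed

end
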